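(* Let $\delta\ge 1$ and $\lambda>0$ be real numbers, and for $x>0$ let $$f_x(y)=\frac{2\lambda x^2}{y^3}\exp\Big(-\frac{\lambda x^2}{y^2}\Big)1_{(0,\infty)}(y).$$ For every integer $i\ge 0$ and every $\sigma>0$, the marginal density $p_{\nu^{i,(\delta)}_\sigma}(y)=\int_0^\infty \nu^{i,(\delta)}_\sigma(dx)\,f_x(y)$ is equal to $$p_{\nu^{i,(\delta)}_\sigma}(y)=1_{(y>0)}\,\frac{2}{\lambda^{1/2}\sigma}\;p_i^{(\delta)}\Big(\frac{y}{\lambda^{1/2}\sigma}\Big),\qquad\text{with}\qquad p_i^{(\delta)}(u)=\frac{(\delta+2i)\,u^{\delta-1+2i}}{(u^2+2)^{i+1+\delta/2}} .$$
   Context: For $\alpha\ge 0$, $C_\alpha=\mathbb E|X|^\alpha$ with $X$ a standard Gaussian random variable. For $i\ge 0$, $\sigma>0$, $$\nu^{i,(\delta)}_\sigma(dx)=1_{(x>0)}\frac{2}{\sigma(2\pi)^{1/2}}\,\frac{x^{\delta-1+2i}}{C_{\delta-1+2i}\,\sigma^{\delta-1+2i}}\exp\Big(-\frac{x^2}{2\sigma^2}\Big)dx,$$ which is a probability measure on $(0,\infty)$. *)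

theory Defs
  imports "HOL-Probability.Probability"
begin

(* E|X|^alpha for X standard Gaussian, via the law of X. For alpha = 0 the convention
   0 powr 0 = 0 only affects the null set {0}. *)
definition gauss_moment :: "real \<Rightarrow> real" where
  "gauss_moment \<alpha> = (\<integral>x. \<bar>x\<bar> powr \<alpha> \<partial>density lborel (\<lambda>x. ennreal (std_normal_density x)))"

definition nu_density :: "nat \<Rightarrow> real \<Rightarrow> real \<Rightarrow> real \<Rightarrow> real" where
  "nu_density i \<delta> \<sigma> x =
     indicator {0<..} x * (2 / (\<sigma> * sqrt (2 * pi)))
       * (x powr (\<delta> - 1 + 2 * real i)
           / (gauss_moment (\<delta> - 1 + 2 * real i) * \<sigma> powr (\<delta> - 1 + 2 * real i)))
       * exp (- (x\<^sup>2 / (2 * \<sigma>\<^sup>2)))"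

definition nu :: "nat \<Rightarrow> real \<Rightarrow> real \<Rightarrow> real measure" where
  "nu i \<delta> \<sigma> = density lborel (\<lambda>x. ennreal (nu_density i \<delta> \<sigma> x))"

definition f_kernel :: "real \<Rightarrow> real \<Rightarrow> real \<Rightarrow> real" where
  "f_kernel lam x y =
     (2 * lam * x\<^sup>2 / y ^ 3) * exp (- (lam * x\<^sup>2 / y\<^sup>2)) * indicator {0<..} y"

definition marginal_density :: "real \<Rightarrow> real measure \<Rightarrow> real \<Rightarrow> real" where
  "marginal_density lam \<mu> y = (LINT x:{0<..}|\<mu>. f_kernel lam x y)"

definition p_fun :: "nat \<Rightarrow> real \<Rightarrow> real \<Rightarrow> real" where
  "p_fun i \<delta> u =
     (\<delta> + 2 * real i) * u powr (\<delta> - 1 + 2 * real i)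
       / (u\<^sup>2 + 2) powr (real i + 1 + \<delta> / 2)"

end

theory Submission
  imports Defs
begin

text \<open>
  With \<open>a = \<delta> - 1 + 2 * i\<close>, both the normalising constant and the marginal density are integrals
  of \<open>x powr b * exp (- c * x^2)\<close> over the half-line, with \<open>b = a\<close> and \<open>b = a + 2\<close> respectively.
  The substitution \<open>t = c * x^2\<close> turns them into Gamma values, and the two Gamma factors cancel by
  \<open>Gamma (s + 1) = s * Gamma s\<close> at \<open>s = (a + 1) / 2\<close>.
\<close>

lemma has_bochner_integral_powr_gaussian:
  fixes a c :: real
  assumes "a > -1" "c > 0"
  shows "has_bochner_integral lborel (\<lambda>x. indicator {0<..} x * (x powr a * exp (- (c * x\<^sup>2))))
           (Gamma ((a + 1) / 2) / (2 * c powr ((a + 1) / 2)))"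
proof -
  define s where "s = (a + 1) / 2"
  have s: "s > 0" and a: "a = 2 * s - 1"
    using assms by (auto simp: s_def field_simps)
  define F where "F = (\<lambda>t::real. t powr (s - 1) / exp t)"
  define h where "h = (\<lambda>x::real. x powr a * exp (- (c * x\<^sup>2)))"
  have "(F has_integral Gamma s) {0..}"
    unfolding F_def by (rule Gamma_integral_real[OF s])
  then have F: "(F has_integral Gamma s) {0<..}"
    by (subst has_integral_spike_set_eq[of _ "{0..}"])
      (auto intro: negligible_subset[of "{0}"])
  \<comment> \<open>The change of variables rule asks for absolute integrability, which comes for
    free because \<open>F\<close> is nonnegative.\<close>
  have "F absolutely_integrable_on {0<..}"
    using F by (intro nonnegative_absolutely_integrable_1) (auto simp: F_def integrable_on_def)
  moreover have image: "(\<lambda>x. c * x\<^sup>2) ` {0<..} = {0<..}"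
  proof (intro equalityI subsetI)
    fix t :: real assume "t \<in> {0<..}"
    then show "t \<in> (\<lambda>x. c * x\<^sup>2) ` {0<..}"
      using assms by (intro image_eqI[of _ _ "sqrt (t / c)"]) auto
  qed (use assms in auto)
  moreover have "inj_on (\<lambda>x. c * x\<^sup>2) {0<..}"
    using assms by (auto intro!: inj_onI simp: power2_eq_iff)
  ultimately have "(\<lambda>x. \<bar>2 * c * x\<bar> * F (c * x\<^sup>2)) absolutely_integrable_on {0<..} \<and>
      integral {0<..} (\<lambda>x. \<bar>2 * c * x\<bar> * F (c * x\<^sup>2)) = Gamma s"
    using F by (subst has_absolute_integral_change_of_variables_1')
      (auto intro!: derivative_eq_intros simp: integral_unique)
  \<comment> \<open>The Jacobian contributes one factor \<open>x\<close> and \<open>F\<close>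
    contributes \<open>x\<close> to the power \<open>2 * (s - 1)\<close>; the total
    \<open>2 * s - 1 = a\<close> explains the choice of \<open>s\<close>.\<close>
  moreover have "\<bar>2 * c * x\<bar> * F (c * x\<^sup>2) = 2 * c powr s * h x" if "x \<in> {0<..}" for x
  proof -
    have "x powr a = x * x\<^sup>2 powr (s - 1)"
      using that powr_add[of x 1 "2 * (s - 1)"]
      by (simp add: a powr_powr flip: powr_numeral)
    moreover have "c powr s = c * c powr (s - 1)"
      using assms powr_add[of c 1 "s - 1"] by simp
    ultimately show ?thesis
      using that assms by (simp add: F_def h_def powr_mult exp_minus field_simps)
  qed
  ultimately have "((\<lambda>x. 2 * c powr s * h x) has_integral Gamma s) {0<..}"
    by (metis (no_types, lifting) has_integral_cong has_integral_integrable_integral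
        absolutely_integrable_on_def)
  from has_integral_mult_right[OF this, of "1 / (2 * c powr s)"]
  have "(h has_integral Gamma s / (2 * c powr s)) {0<..}"
    using assms by simp
  \<comment> \<open>Since \<open>h\<close> is nonnegative, the gauge integral passes to a Lebesgue
    integral, with integrability, by way of \<open>nn_integral\<close>.\<close>
  from nn_integral_has_integral_lebesgue[OF _ this]
  have "(\<integral>\<^sup>+x. ennreal (indicator {0<..} x * h x) \<partial>lborel) = ennreal (Gamma s / (2 * c powr s))"
    by (simp add: h_def)
  moreover have "(\<lambda>x. indicator {0<..} x * h x) \<in> borel_measurable lborel"
    unfolding h_def by measurable
  moreover have "0 \<le> Gamma s" using Gamma_real_pos[OF s] by simp
  ultimately have "has_bochner_integral lborel (\<lambda>x. indicator {0<..} x * h x) (Gamma s / (2 * c powr s))"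
    by (intro has_bochner_integral_nn_integral) (auto simp: h_def)
  then show ?thesis by (simp add: h_def s_def)
qed

text \<open>The integrand is even, so the moment is twice the half-line integral with
  \<open>c = 1/2\<close>.\<close>

lemma gauss_moment_eq:
  assumes "\<alpha> > -1"
  shows "gauss_moment \<alpha> = 2 powr ((\<alpha> + 1) / 2) * Gamma ((\<alpha> + 1) / 2) / sqrt (2 * pi)"
proof -
  let ?f = "\<lambda>x::real. \<bar>x\<bar> powr \<alpha> * exp (- (x\<^sup>2 / 2))"
  let ?I = "Gamma ((\<alpha> + 1) / 2) / (2 * (1 / 2) powr ((\<alpha> + 1) / 2))"
  \<comment> \<open>The rule for even functions wants the closed half-line. Including 0 changes
    nothing even pointwise, as \<open>0 powr \<alpha> = 0\<close> also for
    \<open>\<alpha> = 0\<close>.\<close>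
  have "has_bochner_integral lborel (\<lambda>x. indicator {0..} x *\<^sub>R ?f x) ?I"
    by (rule has_bochner_integral_powr_gaussian[OF assms, of "1/2",
          THEN has_bochner_integral_cong[THEN iffD1, rotated -1]])
       (auto split: split_indicator)
  then have "has_bochner_integral lborel ?f (2 *\<^sub>R ?I)"
    by (rule has_bochner_integral_even_function) auto
  then have "(\<integral>x. ?f x \<partial>lborel) = 2 * ?I"
    by (simp add: has_bochner_integral_iff)
  moreover have "gauss_moment \<alpha> = (\<integral>x. 1 / sqrt (2 * pi) * ?f x \<partial>lborel)"
    unfolding gauss_moment_def
    by (subst integral_density) (auto simp: std_normal_density_def mult_ac)
  ultimately show ?thesis
    by (simp add: powr_divide)
qed

theorem proposition4p3:
  fixes \<delta> lam \<sigma> y :: real and i :: nat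
  assumes "\<delta> \<ge> 1" and "lam > 0" and "\<sigma> > 0"
  shows "marginal_density lam (nu i \<delta> \<sigma>) y =
    indicator {0<..} y * (2 / (sqrt lam * \<sigma>)) * p_fun i \<delta> (y / (sqrt lam * \<sigma>))"
proof (cases "y > 0")
  case False
  then show ?thesis
    by (simp add: marginal_density_def f_kernel_def)
next
  case y: True
  define a where "a = \<delta> - 1 + 2 * real i"
  define s where "s = (a + 1) / 2"
  define u where "u = y / (sqrt lam * \<sigma>)"
  \<comment> \<open>The rates of the two exponentials in \<open>x\<close> add up to
    \<open>c\<close>; \<open>K\<close> collects every factor free of \<open>x\<close>.\<close>
  define c where "c = 1 / (2 * \<sigma>\<^sup>2) + lam / y\<^sup>2"
  define G where "G = Gamma s"
  define K where "K = 2 / (\<sigma> * sqrt (2 * pi)) / (gauss_moment a * \<sigma> powr a) * (2 * lam / y ^ 3)"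
  have a: "a \<ge> 0" using assms by (simp add: a_def)
  then have s: "s > 0" by (simp add: s_def)
  have G: "G > 0" unfolding G_def by (rule Gamma_real_pos[OF s])
  have u: "u > 0" using assms y by (simp add: u_def)
  have c: "c > 0" using assms y by (simp add: c_def add_pos_pos)
  have M: "gauss_moment a = 2 powr s * G / sqrt (2 * pi)"
    using a by (simp add: gauss_moment_eq s_def G_def)
  \<comment> \<open>The measure \<open>nu\<close> is built with \<open>ennreal\<close>, which would
    truncate negative values.\<close>
  have nonneg: "nu_density i \<delta> \<sigma> x \<ge> 0" for x
    using assms G M by (auto simp: nu_density_def simp flip: a_def)
  have meas: "nu_density i \<delta> \<sigma> \<in> borel_measurable borel"
    "f_kernel lam x \<in> borel_measurable borel"
    "(\<lambda>x. f_kernel lam x y) \<in> borel_measurable borel" for x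
    unfolding nu_density_def f_kernel_def by measurable
  have y_eq: "y = u * sqrt lam * \<sigma>"
    using assms by (simp add: u_def)
  \<comment> \<open>Scaling \<open>y\<close> to \<open>u\<close> turns the sum of the two rates into
    a single fraction, the source of \<open>u\<^sup>2 + 2\<close> in \<open>p_fun\<close>.\<close>
  have c_eq: "c = (u\<^sup>2 + 2) / (2 * (\<sigma> * u)\<^sup>2)"
    using assms u by (simp add: c_def y_eq power_mult_distrib field_simps)
  have "marginal_density lam (nu i \<delta> \<sigma>) y =
      (\<integral>x. nu_density i \<delta> \<sigma> x * (indicator {0<..} x * f_kernel lam x y) \<partial>lborel)"
    unfolding marginal_density_def nu_def set_lebesgue_integral_def
    using meas nonneg by (subst integral_density) auto
  \<comment> \<open>The kernel brings the extra \<open>x\<^sup>2\<close>, which raises the exponent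
    to \<open>a + 2\<close> and the Gamma argument to \<open>s + 1\<close>.\<close>
  also have "\<dots> = (\<integral>x. K * (indicator {0<..} x * (x powr (a + 2) * exp (- (c * x\<^sup>2)))) \<partial>lborel)"
  proof (intro Bochner_Integration.integral_cong refl)
    fix x :: real
    have "exp (- (x\<^sup>2 / (2 * \<sigma>\<^sup>2))) * exp (- (lam * x\<^sup>2 / y\<^sup>2)) = exp (- (c * x\<^sup>2))"
      by (simp add: c_def algebra_simps flip: exp_add)
    moreover have "x powr (a + 2) = x powr a * x\<^sup>2" if "x > 0"
      using that by (simp add: powr_add)
    ultimately show "nu_density i \<delta> \<sigma> x * (indicator {0<..} x * f_kernel lam x y) =
        K * (indicator {0<..} x * (x powr (a + 2) * exp (- (c * x\<^sup>2))))"
      using y by (auto simp: nu_density_def f_kernel_def K_def a_def[symmetric] split: split_indicator)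
  qed
  also have "\<dots> = K * (Gamma (s + 1) / (2 * c powr (s + 1)))"
    using has_bochner_integral_powr_gaussian[of "a + 2" c] a c
    by (simp add: has_bochner_integral_iff s_def add_divide_distrib add_ac)
  also have "Gamma (s + 1) = s * G"
    unfolding G_def using s by (intro Gamma_plus1) (auto elim!: nonpos_Ints_cases)
  \<comment> \<open>As \<open>2 * (s + 1) = a + 3\<close>, the denominator of \<open>c\<close>
    yields a cube of \<open>\<sigma> * u\<close>, kept apart to cancel against \<open>y ^ 3\<close>
    in \<open>K\<close>.\<close>
  also have "c powr (s + 1) = (u\<^sup>2 + 2) powr (s + 1) / (2 * 2 powr s * \<sigma> powr a * u powr a * (\<sigma> * u) ^ 3)"
  proof -
    have "((\<sigma> * u)\<^sup>2) powr (s + 1) = (\<sigma> * u) powr (a + 3)"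
      using assms u powr_powr[of "\<sigma> * u" 2 "s + 1"]
      by (simp add: s_def add_ac add_divide_distrib)
    also have "\<dots> = (\<sigma> powr a * u powr a) * (\<sigma> * u) ^ 3"
      using assms u by (simp add: powr_add powr_mult power_mult_distrib)
    finally show ?thesis
      using assms u by (simp add: c_eq powr_divide powr_mult powr_add[of 2])
  qed
  also have "K * (s * G / (2 * ((u\<^sup>2 + 2) powr (s + 1) / (2 * 2 powr s * \<sigma> powr a * u powr a * (\<sigma> * u) ^ 3))))
     = 2 / (sqrt lam * \<sigma>) * (2 * s * u powr a / (u\<^sup>2 + 2) powr (s + 1))"
  proof -
    have "y ^ 3 = u ^ 3 * (lam * sqrt lam) * \<sigma> ^ 3"
      using assms by (simp add: y_eq power_mult_distrib power3_eq_cube)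
    then show ?thesis
      using assms u G y unfolding K_def M
      by (simp add: field_simps power3_eq_cube)
  qed
  \<comment> \<open>Here \<open>2 * s = \<delta> + 2 * i\<close>, hence
    \<open>s + 1 = i + 1 + \<delta> / 2\<close>.\<close>
  also have "2 * s * u powr a / (u\<^sup>2 + 2) powr (s + 1) = p_fun i \<delta> u"
    by (simp add: p_fun_def s_def a_def add_divide_distrib add_ac)
  finally show ?thesis
    using y by (simp add: u_def)
qed

end
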